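(* Let $\beta>1$ be the real number with $\beta^7=\beta^6+1$ (so $\beta\approx1.2254$). Then $T_\beta^7(1)=0$, and the sequence $(T_{-\beta}^n(1))_{n\ge0}$ is aperiodic (i.e. not eventually periodic).
   Context: For real $\beta>1$, $T_{-\beta}:(0,1]\to(0,1]$, $x\mapsto -\beta x+\lfloor \beta x\rfloor+1$, and $T_\beta:[0,1]\to[0,1)$, $x\mapsto\beta x-\lfloor\beta x\rfloor$ (in particular $T_\beta(1)=\beta-\lfloor\beta\rfloor$).
   Formalization: The parenthetical "β≈1.2254" is false for the root of β^7=β^6+1, which is β≈1.2554 (at 1.2254, β^6(β−1)≈0.76, not 1); the formal statement keeps the equation and drops the decimal. *)

theory Defs
  imports "HOL-Analysis.Analysis"
begin

text \<open>
  The two transformations are total on \<^typ>\<open>real\<close>; the lemmas below show that they restrict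
  to self-maps of the intended intervals.
\<close>

definition T_pos :: "real \<Rightarrow> real \<Rightarrow> real" where
  "T_pos \<beta> x = \<beta> * x - of_int \<lfloor>\<beta> * x\<rfloor>"

definition T_neg :: "real \<Rightarrow> real \<Rightarrow> real" where
  "T_neg \<beta> x = - \<beta> * x + of_int \<lfloor>\<beta> * x\<rfloor> + 1"

definition eventually_periodic :: "(nat \<Rightarrow> 'a) \<Rightarrow> bool" where
  "eventually_periodic s \<longleftrightarrow> (\<exists>N p. p > 0 \<and> (\<forall>n\<ge>N. s (n + p) = s n))"

lemma T_pos_range: "T_pos \<beta> x \<in> {0..<1}"
  unfolding T_pos_def by simp linarith

lemma T_neg_range: "T_neg \<beta> x \<in> {0<..1}"
  unfolding T_neg_def by simp linarith

text \<open>The base is well defined.\<close>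

lemma base_ex1: "\<exists>!\<beta>::real. \<beta> > 1 \<and> \<beta> ^ 7 = \<beta> ^ 6 + 1"
proof (rule ex_ex1I)
  have "\<exists>x\<ge>1. x \<le> 2 \<and> x ^ 7 - x ^ 6 = (1::real)"
    by (rule IVT') (auto intro!: continuous_intros)
  then obtain x :: real where "x \<ge> 1" "x ^ 7 - x ^ 6 = 1" by blast
  moreover from this have "x \<noteq> 1" by auto
  ultimately show "\<exists>\<beta>::real. \<beta> > 1 \<and> \<beta> ^ 7 = \<beta> ^ 6 + 1"
    by (intro exI[of _ x]) auto
next
  fix x y :: real
  have less: "a ^ 6 * (a - 1) < b ^ 6 * (b - 1)" if "1 < a" "a < b" for a b :: real
    using that by (intro mult_strict_mono power_strict_mono) auto
  assume "x > 1 \<and> x ^ 7 = x ^ 6 + 1" "y > 1 \<and> y ^ 7 = y ^ 6 + 1"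
  then have "x > 1" "y > 1" "x ^ 6 * (x - 1) = 1" "y ^ 6 * (y - 1) = 1"
    by (auto simp: algebra_simps power_numeral_reduce)
  then show "x = y"
    using less[of x y] less[of y x] by (cases x y rule: linorder_cases) auto
qed

text \<open>
  The literature value 1.2254 has two digits transposed; the root is 1.2554 to four decimals.
\<close>

lemma base_approx:
  fixes \<beta> :: real
  assumes "\<beta> > 1" "\<beta> ^ 7 = \<beta> ^ 6 + 1"
  shows "1.2554 < \<beta>" "\<beta> < 1.25545"
proof -
  have less: "a ^ 6 * (a - 1) \<le> b ^ 6 * (b - 1)" if "1 < a" "a \<le> b" for a b :: real
    using that by (intro mult_mono power_mono) auto
  have eq: "\<beta> ^ 6 * (\<beta> - 1) = 1"
    using assms by (simp add: algebra_simps power_numeral_reduce)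
  show "1.2554 < \<beta>"
    using less[of \<beta> "1.2554"] assms eq by (rule_tac ccontr) (simp add: field_simps)
  show "\<beta> < 1.25545"
    using less[of "1.25545" \<beta>] eq by (rule_tac ccontr) (simp add: field_simps)
qed

end

(*
  Every T_{-\<beta>}^n(1) is an integer polynomial in \<beta>. The polynomial x^7 - x^6 - 1 is irreducible, so
  an eventually periodic orbit would remain eventually periodic after replacing \<beta> by a conjugate
  \<alpha> (keeping the digits). There is a non-real conjugate \<alpha> with |\<alpha>| > 21/20. The conjugate orbit obeys
  v_{n+1} = d_n - \<alpha> v_n with d_n in {1, 2}, so once |v_n| exceeds 40 its modulus increases strictly
  for ever. That this happens at n = 70 is a finite computation in Z[x]/(x^7 - x^6 - 1).
*)

theory Submission
  imports Defs "HOL-Computational_Algebra.Polynomial_Factorial"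
  "HOL-Computational_Algebra.Fundamental_Theorem_Algebra"
begin

section \<open>Integer polynomials and conjugate numbers\<close>

abbreviation ipoly :: "int poly \<Rightarrow> 'a::comm_ring_1 \<Rightarrow> 'a" where
  "ipoly p x \<equiv> poly (map_poly of_int p) x"

lemma ipoly_pCons [simp]: "ipoly (pCons a p) x = of_int a + x * ipoly p x"
  by (simp add: map_poly_pCons)

lemma ipoly_add [simp]: "ipoly (p + q) x = ipoly p x + ipoly q x"
  by (induction p q rule: poly_induct2) (simp_all add: algebra_simps)

lemma ipoly_smult [simp]: "ipoly (smult a p) x = of_int a * ipoly p x"
  by (induction p) (simp_all add: algebra_simps)

lemma ipoly_minus [simp]: "ipoly (p - q) x = ipoly p x - ipoly q x"
  using ipoly_add[of "p - q" q x] by simp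

lemma ipoly_uminus [simp]: "ipoly (- p) x = - ipoly p x"
  using ipoly_minus[of 0 p x] by simp

lemma ipoly_mult [simp]: "ipoly (p * q) x = ipoly p x * ipoly q x"
  by (induction p) (simp_all add: algebra_simps)

text \<open>A polynomial \<open>q\<close> of least degree among the nonzero integer polynomials
  vanishing at \<open>x\<close> divides all the others up to a nonzero integer factor. The prime
  \<open>f\<close> must divide \<open>q\<close>, so \<open>q\<close> vanishes at \<open>y\<close>
  too.\<close>

lemma ipoly_conjugate:
  fixes x :: "'a :: {idom, ring_char_0}" and y :: "'b :: {idom, ring_char_0}"
  assumes f: "irreducible f" "ipoly f x = 0" "ipoly f y = 0"
    and p: "ipoly p x = 0"
  shows "ipoly p y = 0"
proof -
  define Q where "Q q \<longleftrightarrow> q \<noteq> 0 \<and> ipoly q x = 0" for q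
  from f have "Q f" by (auto simp: Q_def)
  then obtain q where q: "Q q" and q_min: "\<And>r. Q r \<Longrightarrow> degree q \<le> degree r"
    using ex_has_least_nat[of Q f degree] by auto
  then have q0: "q \<noteq> 0" "ipoly q x = 0" by (auto simp: Q_def)
  have div: "\<exists>a s. a \<noteq> 0 \<and> smult a r = q * s" if r: "ipoly r x = 0" for r
  proof -
    obtain a s where a: "a \<noteq> 0" and as: "smult a r = q * s + pseudo_mod r q"
      using pseudo_mod(1)[OF q0(1)] by blast
    from as have "pseudo_mod r q = smult a r - q * s" by simp
    with r q0 have "ipoly (pseudo_mod r q) x = 0" by simp
    then have "pseudo_mod r q = 0"
      using q_min[of "pseudo_mod r q"] pseudo_mod(2)[OF q0(1), of r] by (force simp: Q_def)
    with a as show ?thesis by auto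
  qed
  obtain a s where a: "a \<noteq> 0" and as: "smult a f = q * s"
    using div[OF f(2)] by blast
  have "prime_elem f"
    using f(1) by (rule irreducible_imp_prime_elem)
  moreover have "f dvd q * s"
    by (simp flip: as add: dvd_smult)
  ultimately have "f dvd q \<or> f dvd s"
    by (simp add: prime_elem_dvd_mult_iff)
  \<comment> \<open>Cancelling \<open>f\<close> would leave the constant \<open>a\<close> as a
    multiple of \<open>q\<close>, making \<open>q\<close> a nonzero constant with a root.\<close>
  moreover have False if "f dvd s"
  proof -
    from that obtain t where "s = f * t" by blast
    with as have "f * [:a:] = f * (q * t)" by (simp add: mult_ac)
    then have qt: "[:a:] = q * t"
      using f(1) by (metis irreducible_def mult_cancel_left)
    with a have "t \<noteq> 0" by auto
    with qt q0 have "degree q = 0"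
      by (metis add_eq_0_iff_both_eq_0 degree_mult_eq degree_pCons_0)
    with q0 show False by (auto elim!: degree_eq_zeroE)
  qed
  ultimately have "ipoly q y = 0"
    using f(3) by (auto elim!: dvdE)
  moreover obtain b u where b: "b \<noteq> 0" and bu: "smult b p = q * u"
    using div[OF p] by blast
  ultimately have "ipoly (smult b p) y = 0"
    unfolding bu by simp
  with b show ?thesis by simp
qed

section \<open>Irreducibility of \<open>x ^ 7 - x ^ 6 - 1\<close>\<close>

definition base_poly :: "int poly" where
  "base_poly = [:-1, 0, 0, 0, 0, 0, -1, 1:]"

lemma ipoly_base_poly: "ipoly base_poly x = x ^ 7 - x ^ 6 - 1"
  by (simp add: base_poly_def algebra_simps eval_nat_numeral)

lemma degree_base_poly [simp]: "degree base_poly = 7"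
  by (simp add: base_poly_def)

text \<open>Modulo 2 the coefficient equations of a factorisation with such degrees have no solution.\<close>

lemma base_poly_small_factor:
  assumes ab: "base_poly = a * b" and deg: "degree a \<le> 3"
  shows "degree a = 0"
proof (rule ccontr)
  assume "degree a \<noteq> 0"
  with deg have d: "degree a \<in> {1, 2, 3}" by auto
  from ab have nz: "a \<noteq> 0" "b \<noteq> 0" by (auto simp: base_poly_def)
  with ab have sum: "degree a + degree b = 7" by (metis degree_base_poly degree_mult_eq)
  have "lead_coeff a * lead_coeff b = 1"
    by (simp flip: lead_coeff_mult ab add: base_poly_def)
  then have lead: "odd (lead_coeff a)" "odd (lead_coeff b)"
    by (metis even_mult_iff odd_one)+
  have par: "even (coeff base_poly n) = even (\<Sum>i\<le>n. coeff a i * coeff b (n - i))" for n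
    by (simp add: ab coeff_mult)
  have a0: "coeff a i = 0" if "i > degree a" for i using that by (rule coeff_eq_0)
  have b0: "coeff b i = 0" if "i > degree b" for i using that by (rule coeff_eq_0)
  note c = par[of 0] par[of 1] par[of 2] par[of 3] par[of 4] par[of 5] par[of 6] par[of 7]
  note c' = c[unfolded base_poly_def eval_nat_numeral, simplified]
  from d consider "degree a = 1" "degree b = 6" | "degree a = 2" "degree b = 5"
    | "degree a = 3" "degree b = 4" using sum by auto
  then show False
  proof cases
    case 1
    with c' lead a0 b0 show False by (simp add: eval_nat_numeral)
  next
    case 2
    with c' lead a0 b0 show False by (simp add: eval_nat_numeral)
  next
    case 3
    with c' lead a0 b0 show False by (simp add: eval_nat_numeral)
  qed
qed

lemma irreducible_base_poly: "irreducible base_poly"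
proof (rule irreducibleI)
  show "base_poly \<noteq> 0" by (simp add: base_poly_def)
  show "\<not> is_unit base_poly" by (auto simp: is_unit_poly_iff base_poly_def)
next
  fix a b assume ab: "base_poly = a * b"
  have unit: "is_unit p" if "base_poly = p * q" "degree p = 0" for p q
  proof -
    from that(2) obtain c where c: "p = [:c:]" by (auto elim: degree_eq_zeroE)
    have "lead_coeff p * lead_coeff q = 1"
      by (simp flip: lead_coeff_mult that(1) add: base_poly_def)
    with c have "c dvd 1" by (metis dvd_triv_left lead_coeff_pCons(2))
    with c show ?thesis by (auto simp: is_unit_poly_iff)
  qed
  from ab have "a \<noteq> 0" "b \<noteq> 0" by (auto simp: base_poly_def)
  with ab have "degree a + degree b = 7" by (metis degree_base_poly degree_mult_eq)
  then consider "degree a \<le> 3" | "degree b \<le> 3" by linarith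
  then show "is_unit a \<or> is_unit b"
    using unit base_poly_small_factor ab by cases (metis mult.commute)+
qed

section \<open>Approximate roots and perturbation of powers\<close>

text \<open>
  The logarithmic derivative of \<open>p\<close> at \<open>z\<close> is the sum of the reciprocals of \<open>z - w\<close> over all
  roots \<open>w\<close>, so its modulus is at most \<open>degree p / \<epsilon>\<close> if no root is closer than \<open>\<epsilon>\<close>.
\<close>

lemma complex_root_near:
  fixes p :: "complex poly"
  assumes "degree p * cmod (poly p z) < \<epsilon> * cmod (poly (pderiv p) z)"
  obtains w where "poly p w = 0" "cmod (w - z) < \<epsilon>"
proof -
  define c where "c = lead_coeff p"
  obtain root where root: "smult c (\<Prod>i<degree p. [:-root i, 1:]) = p"
    unfolding c_def by (rule complex_poly_decompose')
  have p: "poly p x = c * (\<Prod>i<degree p. x - root i)" for x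
    by (subst root[symmetric]) (simp add: poly_prod)
  have p': "poly (pderiv p) x = (\<Sum>i<degree p. c * (\<Prod>j\<in>{..<degree p} - {i}. x - root j))" for x
    by (subst root[symmetric])
       (simp add: poly_prod poly_sum pderiv_smult pderiv_prod pderiv_pCons sum_distrib_left)
  have "\<exists>i<degree p. cmod (z - root i) < \<epsilon>"
  proof (rule ccontr)
    assume far: "\<not> ?thesis"
    have "\<epsilon> * cmod (c * (\<Prod>j\<in>{..<degree p} - {i}. z - root j)) \<le> cmod (poly p z)"
      if "i < degree p" for i
    proof -
      have "cmod (poly p z) = cmod (z - root i) * cmod (c * (\<Prod>j\<in>{..<degree p} - {i}. z - root j))"
        using that by (simp add: p norm_mult prod.remove[of _ i])
      moreover have "\<epsilon> \<le> cmod (z - root i)"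
        using far that by force
      ultimately show ?thesis
        by (simp only: mult_right_mono norm_ge_zero)
    qed
    then have le: "(\<Sum>i<degree p. \<epsilon> * cmod (c * (\<Prod>j\<in>{..<degree p} - {i}. z - root j)))
      \<le> degree p * cmod (poly p z)"
      by (rule order_trans[OF sum_bounded_above]) auto
    have "\<epsilon> * cmod (poly (pderiv p) z)
      \<le> (\<Sum>i<degree p. \<epsilon> * cmod (c * (\<Prod>j\<in>{..<degree p} - {i}. z - root j)))" if "\<epsilon> \<ge> 0"
      unfolding p' sum_distrib_left[where r = \<epsilon>, symmetric] using that by (intro mult_left_mono norm_sum)
    moreover have "\<epsilon> * cmod (poly (pderiv p) z) \<le> degree p * cmod (poly p z)" if "\<epsilon> < 0"
      using that by (intro order_trans[OF mult_nonpos_nonneg]) auto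
    ultimately show False
      using assms le by linarith
  qed
  then obtain i where i: "i < degree p" "cmod (root i - z) < \<epsilon>"
    by (auto simp: norm_minus_commute)
  then have "poly p (root i) = 0"
    by (auto simp: p intro!: prod_zero)
  with i(2) show ?thesis by (rule_tac that)
qed

text \<open>The quotient by \<open>x - y\<close> is a sum of \<open>n\<close> products of
  \<open>n - 1\<close> factors of norm at most \<open>M\<close>. This carries numerical estimates
  from an approximate root to the exact one.\<close>

lemma norm_power_diff_le:
  fixes x y :: "'a :: {real_normed_algebra_1, comm_ring_1}"
  assumes "norm x \<le> M" "norm y \<le> M"
  shows "norm (x ^ n - y ^ n) \<le> n * M ^ (n - 1) * norm (x - y)"
proof -
  have M: "M \<ge> 0" using assms(1) norm_ge_zero order_trans by blast
  have "norm (x ^ n - y ^ n) \<le> norm (x - y) * norm (\<Sum>i<n. y ^ (n - Suc i) * x ^ i)"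
    by (subst power_diff_sumr2) (rule norm_mult_ineq)
  also have "\<dots> \<le> norm (x - y) * (\<Sum>i<n. M ^ (n - 1))"
  proof (intro mult_left_mono sum_norm_le)
    fix i assume i: "i \<in> {..<n}"
    have "norm (y ^ (n - Suc i) * x ^ i) \<le> norm y ^ (n - Suc i) * norm x ^ i"
      by (meson mult_mono norm_ge_zero norm_mult_ineq norm_power_ineq order_trans zero_le_power)
    also have "\<dots> \<le> M ^ (n - Suc i) * M ^ i"
      using assms M by (intro mult_mono power_mono) auto
    also have "\<dots> = M ^ (n - 1)"
      using i by (simp flip: power_add)
    finally show "norm (y ^ (n - Suc i) * x ^ i) \<le> M ^ (n - 1)" .
  qed simp
  finally show ?thesis by (simp add: mult_ac)
qed

section \<open>Certified orbit computation in the residue ring\<close>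

text \<open>
  \<open>(a, b, c, d, e, f, g)\<close> stands for \<open>a + b x + \<dots> + g x\<^sup>6\<close> in \<open>\<int>[x]/(x\<^sup>7 - x\<^sup>6 - 1)\<close>;
  \<open>advance k\<close> is the map \<open>v \<mapsto> k - x v\<close> there.
\<close>

type_synonym coeffs7 = "int \<times> int \<times> int \<times> int \<times> int \<times> int \<times> int"

fun eval7 :: "'a::comm_ring_1 \<Rightarrow> coeffs7 \<Rightarrow> 'a" where
  "eval7 x (a, b, c, d, e, f, g) = of_int a + of_int b * x + of_int c * x ^ 2 + of_int d * x ^ 3 +
     of_int e * x ^ 4 + of_int f * x ^ 5 + of_int g * x ^ 6"

fun advance :: "int \<Rightarrow> coeffs7 \<Rightarrow> coeffs7" where
  "advance k (a, b, c, d, e, f, g) = (k - g, - a, - b, - c, - d, - e, - f - g)"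

text \<open>The overflow \<open>g * x ^ 7\<close> folds back to \<open>g * x ^ 6 + g\<close>, whence
  the entries \<open>k - g\<close> and \<open>- f - g\<close> of \<open>advance\<close>.\<close>

lemma eval7_advance:
  fixes x :: "'a :: comm_ring_1"
  assumes "x ^ 7 = x ^ 6 + 1"
  shows "eval7 x (advance k c) = of_int k - x * eval7 x c"
proof -
  obtain a0 a1 a2 a3 a4 a5 a6 where c: "c = (a0, a1, a2, a3, a4, a5, a6)"
    by (metis prod.collapse)
  have "x * x ^ 6 = x ^ 6 + 1"
    using assms by (simp flip: power_Suc)
  then have "x * (of_int a6 * x ^ 6) = of_int a6 * (x ^ 6 + 1)"
    by (metis mult.left_commute)
  then show ?thesis
    by (simp add: c algebra_simps) (simp add: algebra_simps power_numeral_reduce)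
qed

text \<open>
  The coefficients are \<open>10\<^sup>6 \<beta>\<^sup>i\<close> rounded to integers, so \<open>approx7 v\<close> differs from \<open>10\<^sup>6\<close> times
  the value of \<open>v\<close> at \<open>\<beta>\<close> by at most \<open>weight7 v\<close>.
\<close>

fun approx7 :: "coeffs7 \<Rightarrow> int" where
  "approx7 (a, b, c, d, e, f, g) =
     1000000 * a + 1255423 * b + 1576087 * c + 1978655 * d + 2484049 * e + 3118532 * f + 3915076 * g"

fun weight7 :: "coeffs7 \<Rightarrow> int" where
  "weight7 (a, b, c, d, e, f, g) = \<bar>a\<bar> + \<bar>b\<bar> + \<bar>c\<bar> + \<bar>d\<bar> + \<bar>e\<bar> + \<bar>f\<bar> + \<bar>g\<bar>"

text \<open>\<open>t ^ 6 * (t - 1)\<close> increases for \<open>t > 1\<close> and equals 1 at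
  \<beta>. The bounds are tight enough to keep \<open>1000000 * \<beta> ^ i\<close> for
  \<open>i \<le> 6\<close> within 1 of the integers in \<open>approx7\<close>.\<close>

lemma base_bounds:
  fixes \<beta> :: real
  assumes "\<beta> > 1" "\<beta> ^ 7 = \<beta> ^ 6 + 1"
  shows "1.25542287 \<le> \<beta>" "\<beta> \<le> 1.25542288"
proof -
  have less: "a ^ 6 * (a - 1) \<le> b ^ 6 * (b - 1)" if "1 < a" "a \<le> b" for a b :: real
    using that by (intro mult_mono power_mono) auto
  have eq: "\<beta> ^ 6 * (\<beta> - 1) = 1"
    using assms by (simp add: algebra_simps power_numeral_reduce)
  show "1.25542287 \<le> \<beta>"
    using less[of \<beta> "1.25542287"] assms eq by (rule_tac ccontr) (simp add: field_simps)
  show "\<beta> \<le> 1.25542288"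
    using less[of "1.25542288" \<beta>] eq by (rule_tac ccontr) (simp add: field_simps)
qed

lemma approx7:
  fixes \<beta> :: real
  assumes "\<beta> > 1" "\<beta> ^ 7 = \<beta> ^ 6 + 1"
  shows "\<bar>1000000 * eval7 \<beta> v - of_int (approx7 v)\<bar> \<le> of_int (weight7 v)"
proof -
  obtain a b c d e f g where v: "v = (a, b, c, d, e, f, g)"
    by (metis prod.collapse)
  note bnd = base_bounds[OF assms]
  have pow: "1.25542287 ^ n \<le> \<beta> ^ n" "\<beta> ^ n \<le> 1.25542288 ^ n" for n
    using bnd assms(1) by (auto intro!: power_mono)
  have mul: "\<bar>of_int z * t\<bar> \<le> \<bar>of_int z\<bar>" if "\<bar>t\<bar> \<le> 1" for z :: int and t :: real
    using that by (simp add: abs_mult mult_left_le)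
  have tri: "\<bar>t + t'\<bar> \<le> s + s'" if "\<bar>t\<bar> \<le> s" "\<bar>t'\<bar> \<le> s'" for s t s' t' :: real
    using that by linarith
  have p1: "\<bar>of_int b * (1000000 * \<beta> - 1255423)\<bar> \<le> \<bar>of_int b\<bar>"
    using bnd by (intro mul) (simp add: abs_le_iff)
  have p2: "\<bar>of_int c * (1000000 * \<beta> ^ 2 - 1576087)\<bar> \<le> \<bar>of_int c\<bar>"
    using pow[of 2] by (intro mul) (simp add: abs_le_iff power_numeral_reduce)
  have p3: "\<bar>of_int d * (1000000 * \<beta> ^ 3 - 1978655)\<bar> \<le> \<bar>of_int d\<bar>"
    using pow[of 3] by (intro mul) (simp add: abs_le_iff power_divide)
  have p4: "\<bar>of_int e * (1000000 * \<beta> ^ 4 - 2484049)\<bar> \<le> \<bar>of_int e\<bar>"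
    using pow[of 4] by (intro mul) (simp add: abs_le_iff power_divide)
  have p5: "\<bar>of_int f * (1000000 * \<beta> ^ 5 - 3118532)\<bar> \<le> \<bar>of_int f\<bar>"
    using pow[of 5] by (intro mul) (simp add: abs_le_iff power_divide)
  have p6: "\<bar>of_int g * (1000000 * \<beta> ^ 6 - 3915076)\<bar> \<le> \<bar>of_int g\<bar>"
    using pow[of 6] by (intro mul) (simp add: abs_le_iff power_divide)
  have "1000000 * eval7 \<beta> v - of_int (approx7 v) =
    of_int b * (1000000 * \<beta> - 1255423) + of_int c * (1000000 * \<beta> ^ 2 - 1576087) +
    of_int d * (1000000 * \<beta> ^ 3 - 1978655) + of_int e * (1000000 * \<beta> ^ 4 - 2484049) +
    of_int f * (1000000 * \<beta> ^ 5 - 3118532) + of_int g * (1000000 * \<beta> ^ 6 - 3915076)"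
    by (simp add: v algebra_simps)
  also have "\<bar>\<dots>\<bar> \<le> \<bar>of_int b\<bar> + \<bar>of_int c\<bar> + \<bar>of_int d\<bar> + \<bar>of_int e\<bar> + \<bar>of_int f\<bar> + \<bar>of_int g\<bar>"
    by (rule tri[OF tri[OF tri[OF tri[OF tri[OF p1 p2] p3] p4] p5] p6])
  also have "\<dots> \<le> of_int (weight7 v)"
    by (simp add: v)
  finally show ?thesis .
qed

text \<open>
  The choice of digit in \<open>next7\<close> is only a guess based on approximate values; \<open>admissible7\<close>
  confirms it, as the true digit is the one for which the next point lies in \<open>(0, 1]\<close>.
\<close>

definition next7 :: "coeffs7 \<Rightarrow> coeffs7" where
  "next7 v = (if approx7 (advance 1 v) > 0 then advance 1 v else advance 2 v)"

definition admissible7 :: "coeffs7 \<Rightarrow> bool" where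
  "admissible7 v \<longleftrightarrow> weight7 v < approx7 v \<and> approx7 v + weight7 v \<le> 1000000"

primrec certify7 :: "nat \<Rightarrow> coeffs7 \<Rightarrow> coeffs7 option" where
  "certify7 0 v = Some v"
| "certify7 (Suc n) v = (if admissible7 (next7 v) then certify7 n (next7 v) else None)"

lemma admissible7:
  fixes \<beta> :: real
  assumes "\<beta> > 1" "\<beta> ^ 7 = \<beta> ^ 6 + 1" "admissible7 v"
  shows "0 < eval7 \<beta> v" "eval7 \<beta> v \<le> 1"
proof -
  from assms(3) have "of_int (weight7 v) < (of_int (approx7 v) :: real)"
    and "of_int (approx7 v) + of_int (weight7 v) \<le> (1000000 :: real)"
    by (simp_all add: admissible7_def flip: of_int_add)
  with approx7[OF assms(1,2), of v] show "0 < eval7 \<beta> v" "eval7 \<beta> v \<le> 1"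
    by linarith+
qed

text \<open>All 70 steps are integer arithmetic, so plain evaluation settles them. The start is the
  constant 1, the initial orbit point.\<close>

lemma certify7_orbit: "certify7 70 (1, 0, 0, 0, 0, 0, 0) = Some (-14, -13, -4, 4, 12, 10, -8)"
  by (simp add: next7_def admissible7_def eval_nat_numeral)

text \<open>The digits come from the real orbit while the variable stays formal, so the same digits
  can be used at a conjugate of \<beta>.\<close>

primrec orbit_poly :: "real \<Rightarrow> nat \<Rightarrow> int poly" where
  "orbit_poly \<beta> 0 = 1"
| "orbit_poly \<beta> (Suc n) = [:\<lfloor>\<beta> * (T_neg \<beta> ^^ n) 1\<rfloor> + 1:] - pCons 0 (orbit_poly \<beta> n)"

lemma ipoly_orbit_poly: "ipoly (orbit_poly \<beta> n) \<beta> = (T_neg \<beta> ^^ n) 1"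
proof (induction n)
  case (Suc n)
  then show ?case
    by (simp add: T_neg_def[of \<beta> "(T_neg \<beta> ^^ n) 1"])
qed simp

lemma T_neg_digit:
  fixes \<beta> x :: real
  assumes "0 < of_int k - \<beta> * x" "of_int k - \<beta> * x \<le> 1"
  shows "\<lfloor>\<beta> * x\<rfloor> + 1 = k"
  using assms by linarith

text \<open>Two evaluations run in parallel: admissibility puts the value at \<beta> in (0, 1],
  which proves the guessed digit to be the true one, and the value at \<alpha> then follows the same
  digit.\<close>

lemma certify7_sound:
  fixes \<beta> :: real and \<alpha> :: "'a :: comm_ring_1"
  assumes "\<beta> > 1" "\<beta> ^ 7 = \<beta> ^ 6 + 1" "\<alpha> ^ 7 = \<alpha> ^ 6 + 1"
    and "certify7 n v = Some w"
    and "eval7 \<beta> v = (T_neg \<beta> ^^ m) 1" "eval7 \<alpha> v = ipoly (orbit_poly \<beta> m) \<alpha>"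
  shows "eval7 \<alpha> w = ipoly (orbit_poly \<beta> (m + n)) \<alpha>"
  using assms(4-)
proof (induction n arbitrary: v m)
  case (Suc n)
  from Suc.prems(1) have adm: "admissible7 (next7 v)" and w: "certify7 n (next7 v) = Some w"
    by (auto split: if_splits)
  obtain k where k: "next7 v = advance k v"
    by (metis next7_def)
  have eq: "eval7 \<beta> (next7 v) = of_int k - \<beta> * (T_neg \<beta> ^^ m) 1"
    by (simp add: k eval7_advance[OF assms(2)] Suc.prems)
  with admissible7[OF assms(1,2) adm] have digit: "\<lfloor>\<beta> * (T_neg \<beta> ^^ m) 1\<rfloor> + 1 = k"
    by (intro T_neg_digit) auto
  then have "eval7 \<beta> (next7 v) = (T_neg \<beta> ^^ Suc m) 1"
    by (simp add: eq T_neg_def flip: digit)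
  moreover have "eval7 \<alpha> (next7 v) = ipoly (orbit_poly \<beta> (Suc m)) \<alpha>"
    by (simp add: k eval7_advance[OF assms(3)] Suc.prems digit del: of_int_add)
  ultimately show ?case
    using Suc.IH[OF w, of "Suc m"] by simp
qed simp

section \<open>A conjugate outside the unit circle\<close>

lemma expanding_conjugate:
  obtains \<alpha> :: complex where "\<alpha> ^ 7 = \<alpha> ^ 6 + 1" "cmod \<alpha> > 21 / 20"
    "cmod (eval7 \<alpha> (-14, -13, -4, 4, 12, 10, -8)) > 40"
proof -
  \<comment> \<open>A decimal approximation to a root; its modulus, about 1.0517, exceeds 21/20 by
    more than the error 1/1000 allowed below.\<close>
  define z where "z = Complex 0.7802 0.7053"
  define p :: "complex poly" where "p = [:-1, 0, 0, 0, 0, 0, -1, 1:]"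
  have p: "poly p x = x ^ 7 - x ^ 6 - 1" for x
    by (simp add: p_def algebra_simps power_numeral_reduce)
  have "\<bar>Re (poly p z)\<bar> + \<bar>Im (poly p z)\<bar> < 1 / 2000"
    by (simp add: p_def z_def)
  then have small: "cmod (poly p z) < 1 / 2000"
    using cmod_le[of "poly p z"] by simp
  have "Im (poly (pderiv p) z) < - 5"
    by (simp add: p_def z_def pderiv_pCons)
  then have steep: "cmod (poly (pderiv p) z) > 5"
    using abs_Im_le_cmod[of "poly (pderiv p) z"] by simp
  \<comment> \<open>The degree is 7, and \<open>7 / 2000 < 5 / 1000\<close>.\<close>
  have "degree p * cmod (poly p z) < 1 / 1000 * cmod (poly (pderiv p) z)"
    using small steep by (simp add: p_def)
  then obtain \<alpha> where \<alpha>: "poly p \<alpha> = 0" "cmod (\<alpha> - z) < 1 / 1000"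
    by (rule complex_root_near)
  have "1.0517\<^sup>2 < (cmod z)\<^sup>2" "(cmod z)\<^sup>2 < 1.0518\<^sup>2"
    unfolding cmod_power2 by (simp_all add: z_def power_divide)
  then have z: "1.0517 < cmod z" "cmod z < 1.0518"
    using power_less_imp_less_base[of "1.0517" 2 "cmod z"]
      power_less_imp_less_base[of "cmod z" 2 "1.0518"] by simp_all
  have "cmod z - cmod (\<alpha> - z) \<le> cmod \<alpha>" "cmod \<alpha> \<le> cmod z + cmod (\<alpha> - z)"
    using norm_triangle_ineq2[of z "z - \<alpha>"] norm_triangle_ineq[of z "\<alpha> - z"]
    by (simp_all add: norm_minus_commute)
  with z \<alpha>(2) have big: "cmod \<alpha> > 21 / 20" and le: "cmod \<alpha> \<le> 1.1" "cmod z \<le> 1.1"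
    by simp_all
  have pow: "cmod (of_int k * (\<alpha> ^ n - z ^ n)) \<le> \<bar>of_int k\<bar> * (n * 1.1 ^ (n - 1) * (1 / 1000))"
    for k n
  proof -
    have "cmod (\<alpha> ^ n - z ^ n) \<le> n * 1.1 ^ (n - 1) * cmod (\<alpha> - z)"
      by (rule norm_power_diff_le[OF le])
    also have "\<dots> \<le> n * 1.1 ^ (n - 1) * (1 / 1000)"
      using \<alpha>(2) by (intro mult_left_mono) auto
    finally show ?thesis
      unfolding norm_mult norm_of_int by (rule mult_left_mono) simp
  qed
  let ?c = "(-14, -13, -4, 4, 12, 10, -8) :: coeffs7"
  have diff: "eval7 \<alpha> ?c - eval7 z ?c =
    of_int (-13) * (\<alpha> ^ 1 - z ^ 1) + of_int (-4) * (\<alpha> ^ 2 - z ^ 2) + of_int 4 * (\<alpha> ^ 3 - z ^ 3) +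
    of_int 12 * (\<alpha> ^ 4 - z ^ 4) + of_int 10 * (\<alpha> ^ 5 - z ^ 5) + of_int (-8) * (\<alpha> ^ 6 - z ^ 6)"
    by (simp add: algebra_simps)
  \<comment> \<open>The bounds add up to about 0.25, well below the gap between 41 at
    \<open>z\<close> and 40 at \<alpha>.\<close>
  have "cmod (eval7 \<alpha> ?c - eval7 z ?c) \<le> 13 * (1 / 1000) + 4 * (2 * 1.1 / 1000) + 4 * (3 * 1.1 ^ 2 / 1000) +
    12 * (4 * 1.1 ^ 3 / 1000) + 10 * (5 * 1.1 ^ 4 / 1000) + 8 * (6 * 1.1 ^ 5 / 1000)"
    unfolding diff by (intro norm_triangle_mono; rule order_trans[OF pow]; simp)
  also have "\<dots> < 1"
    by (simp add: power_divide)
  finally have "cmod (eval7 \<alpha> ?c - eval7 z ?c) < 1" .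
  moreover have "cmod (eval7 z ?c) > 41"
  proof -
    have horner: "eval7 z ?c = -14 + z * (-13 + z * (-4 + z * (4 + z * (12 + z * (10 - 8 * z)))))"
      by (simp add: algebra_simps power_numeral_reduce)
    have "Re (eval7 z ?c) < -41"
      unfolding horner by (simp add: z_def)
    then show ?thesis
      using abs_Re_le_cmod[of "eval7 z ?c"] by linarith
  qed
  ultimately have "cmod (eval7 \<alpha> ?c) > 40"
    using norm_triangle_sub[of "eval7 z ?c" "eval7 \<alpha> ?c"]
      norm_minus_commute[of "eval7 z ?c" "eval7 \<alpha> ?c"] by linarith
  moreover have "\<alpha> ^ 7 = \<alpha> ^ 6 + 1"
    using \<alpha>(1) by (simp add: p algebra_simps)
  ultimately show ?thesis
    using big that by blast
qed

section \<open>The orbits of 1 under both maps\<close>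

text \<open>For \<open>n > 0\<close> the number \<open>1 / \<beta> ^ n\<close> lies in (0, 1) and is
  its own fractional part; for \<open>n = 0\<close> it is 1, with fractional part 0.\<close>

lemma T_pos_reciprocal_power:
  assumes "\<beta> > 1"
  shows "T_pos \<beta> (1 / \<beta> ^ Suc n) = (if n = 0 then 0 else 1 / \<beta> ^ n)"
proof -
  have "\<lfloor>1 / \<beta> ^ n\<rfloor> = 0" if "n > 0"
    using assms that by (simp add: floor_eq_iff divide_less_eq one_less_power)
  then show ?thesis
    using assms by (auto simp: T_pos_def)
qed

lemma T_neg_orbit_range:
  "0 < (T_neg \<beta> ^^ n) 1 \<and> (T_neg \<beta> ^^ n) 1 \<le> 1"
  using T_neg_range[of \<beta>] by (cases n) auto

lemma orbit_poly_step_norm: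
  fixes \<alpha> :: complex
  assumes "1 < \<beta>" "\<beta> < 2"
  shows "cmod (ipoly (orbit_poly \<beta> (Suc n)) \<alpha>) \<ge> cmod \<alpha> * cmod (ipoly (orbit_poly \<beta> n) \<alpha>) - 2"
proof -
  let ?x = "(T_neg \<beta> ^^ n) 1" and ?v = "ipoly (orbit_poly \<beta> n) \<alpha>"
  have "0 < \<beta> * ?x"
    using T_neg_orbit_range[of n \<beta>] assms by simp
  moreover have "\<beta> * ?x \<le> \<beta>"
    using T_neg_orbit_range[of n \<beta>] assms by (intro mult_left_le) auto
  then have "\<beta> * ?x < 2"
    using assms by linarith
  ultimately have "\<lfloor>\<beta> * ?x\<rfloor> \<in> {0, 1}"
    by (auto simp: floor_eq_iff)
  then have "cmod (of_int (\<lfloor>\<beta> * ?x\<rfloor> + 1)) \<le> 2"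
    by auto
  moreover have "ipoly (orbit_poly \<beta> (Suc n)) \<alpha> = of_int (\<lfloor>\<beta> * ?x\<rfloor> + 1) - \<alpha> * ?v"
    by simp
  ultimately show ?thesis
    using norm_triangle_ineq2[of "\<alpha> * ?v" "of_int (\<lfloor>\<beta> * ?x\<rfloor> + 1)"]
    by (simp add: norm_minus_commute norm_mult)
qed

theorem proposition6p2:
  fixes \<beta> :: real
  assumes "\<beta> > 1" and "\<beta> ^ 7 = \<beta> ^ 6 + 1"
  shows "(T_pos \<beta> ^^ 7) 1 = 0 \<and> \<not> eventually_periodic (\<lambda>n. (T_neg \<beta> ^^ n) 1)"
proof
  have \<beta>2: "\<beta> < 2"
    using base_bounds[OF assms] by simp
  then have "\<lfloor>\<beta>\<rfloor> = 1"
    using assms by (simp add: floor_eq_iff)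
  \<comment> \<open>Thus \<open>\<beta> - 1\<close>, the first image of 1, is a reciprocal power of
    \<beta>, and six further steps reach 0.\<close>
  moreover have "(\<beta> - 1) * \<beta> ^ 6 = 1"
    using assms by (simp add: algebra_simps flip: power_Suc)
  ultimately have "T_pos \<beta> 1 = 1 / \<beta> ^ 6"
    using assms by (simp add: T_pos_def eq_divide_eq)
  then show "(T_pos \<beta> ^^ 7) 1 = 0"
    using T_pos_reciprocal_power[OF assms(1), of 5] T_pos_reciprocal_power[OF assms(1), of 4]
      T_pos_reciprocal_power[OF assms(1), of 3] T_pos_reciprocal_power[OF assms(1), of 2]
      T_pos_reciprocal_power[OF assms(1), of 1] T_pos_reciprocal_power[OF assms(1), of 0]
    by (simp add: eval_nat_numeral)
  obtain \<alpha> :: complex where \<alpha>: "\<alpha> ^ 7 = \<alpha> ^ 6 + 1" "cmod \<alpha> > 21 / 20"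
    "cmod (eval7 \<alpha> (-14, -13, -4, 4, 12, 10, -8)) > 40"
    by (rule expanding_conjugate)
  define v where "v n = ipoly (orbit_poly \<beta> n) \<alpha>" for n
  have "eval7 \<alpha> (-14, -13, -4, 4, 12, 10, -8) = v (0 + 70)"
    unfolding v_def by (rule certify7_sound[OF assms \<alpha>(1) certify7_orbit]) simp_all
  with \<alpha>(3) have v70: "cmod (v 70) > 40"
    by (simp del: eval7.simps)
  have step: "cmod (v (Suc n)) > cmod (v n)" if "cmod (v n) > 40" for n
  proof -
    \<comment> \<open>The threshold 40 is the solution of
      \<open>21 / 20 * r - 2 = r\<close>.\<close>
    have "cmod \<alpha> * cmod (v n) \<ge> 21 / 20 * cmod (v n)"
      using \<alpha>(2) by (intro mult_right_mono) auto
    with orbit_poly_step_norm[OF assms(1) \<beta>2, of \<alpha> n] that show ?thesis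
      unfolding v_def by linarith
  qed
  have large: "cmod (v n) > 40" if "n \<ge> 70" for n
    using that by (induction n rule: dec_induct) (use v70 step in \<open>auto intro: less_trans\<close>)
  have increasing: "cmod (v n) < cmod (v (n + Suc p))" if "n \<ge> 70" for n p
    by (induction p) (use that step large in \<open>auto intro: less_trans\<close>)
  show "\<not> eventually_periodic (\<lambda>n. (T_neg \<beta> ^^ n) 1)"
  proof
    assume "eventually_periodic (\<lambda>n. (T_neg \<beta> ^^ n) 1)"
    then obtain N p where "p > 0" and per: "\<forall>n\<ge>N. (T_neg \<beta> ^^ (n + p)) 1 = (T_neg \<beta> ^^ n) 1"
      unfolding eventually_periodic_def by blast
    \<comment> \<open>This index lies beyond both the preperiod and the start of the growth. A
      repetition there is an integer relation for \<beta>, hence one for \<alpha>, where the moduli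
      strictly increase.\<close>
    define n where "n = max N 70"
    let ?d = "orbit_poly \<beta> (n + p) - orbit_poly \<beta> n"
    have "ipoly ?d \<beta> = 0"
      using per by (simp add: ipoly_orbit_poly n_def)
    then have "ipoly ?d \<alpha> = 0"
      by (rule ipoly_conjugate[OF irreducible_base_poly, rotated 2])
         (simp_all add: ipoly_base_poly assms \<alpha>)
    then have "v (n + p) = v n"
      by (simp add: v_def)
    moreover have "cmod (v n) < cmod (v (n + Suc (p - 1)))"
      by (rule increasing) (simp add: n_def)
    ultimately show False
      using \<open>p > 0\<close> by simp
  qed
qed

end
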